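(* Let $X$ be a topological space and $x_0\in X$. Then $X$ is SSLT at $x_0$ if and only if $\pi_1^{s}(X,x_0)=\pi_1^{sg}(X,x_0)$.
   Context: Let $I=[0,1]$; $P(X,x_0)$ denotes the set of paths $\alpha:I\to X$ with $\alpha(0)=x_0$; $\ast$ denotes concatenation and $\alpha^{-1}$ the reversed path. A loop $\alpha$ in $X$ based at $x$ is small if for every open neighborhood $U$ of $x$ the class $[\alpha]\in\pi_1(X,x)$ has a representative lying in $U$. $\pi_1^{s}(X,x)$ is the subgroup of $\pi_1(X,x)$ consisting of the homotopy classes of all small loops based at $x$. $\pi_1^{sg}(X,x_0)$ is the subgroup of $\pi_1(X,x_0)$ generated by the set $\{[\alpha\ast\beta\ast\alpha^{-1}] \mid [\beta]\in\pi_1^{s}(X,\alpha(1)),\ \alpha\in P(X,x_0)\}$. The space $X$ is SSLT (small "small loop" transfer) at $x_0$ if for every path $\alpha$ in $X$ starting at $x_0$ and every open neighborhood $U$ of $x_0=\alpha(0)$ there is an open neighborhood $V$ of $x_1=\alpha(1)$ such that for every small loop $\beta:I\to V$ based at $x_1$ (small as a loop in $X$) there is a loop $\gamma$ in $U$ based at $x_0$ that is homotopic in $X$ to $\alpha\ast\beta\ast\alpha^{-1}$ relative to $\{0,1\}$. *)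

theory Defs
  imports "HOL-Analysis.Analysis" "HOL-Algebra.Generated_Groups"
begin

text \<open>
  The space \<open>X\<close> is a set in a type of class \<open>topological_space\<close>, with the subspace topology.
  Its paths and homotopies are those of the library: \<open>+++\<close> is concatenation and
  \<open>homotopic_paths X\<close> is homotopy in \<open>X\<close> relative to \<open>{0, 1}\<close>. Only the values of a path on
  \<open>{0..1}\<close> matter; functions that agree there have the same homotopy class.
\<close>

definition paths_from :: "'a::topological_space set \<Rightarrow> 'a \<Rightarrow> (real \<Rightarrow> 'a) set" where
  "paths_from X x = {\<alpha>. path \<alpha> \<and> path_image \<alpha> \<subseteq> X \<and> pathstart \<alpha> = x}"

definition loops_at :: "'a::topological_space set \<Rightarrow> 'a \<Rightarrow> (real \<Rightarrow> 'a) set" where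
  "loops_at X x = {\<alpha> \<in> paths_from X x. pathfinish \<alpha> = x}"

definition path_class :: "'a::topological_space set \<Rightarrow> (real \<Rightarrow> 'a) \<Rightarrow> (real \<Rightarrow> 'a) set" where
  "path_class X \<alpha> = {\<beta>. homotopic_paths X \<alpha> \<beta>}"

text \<open>The product of two classes is the class of the concatenation of any representatives.\<close>

definition fundamental_group ::
    "'a::topological_space set \<Rightarrow> 'a \<Rightarrow> (real \<Rightarrow> 'a) set monoid" where
  "fundamental_group X x =
     \<lparr> carrier = path_class X ` loops_at X x,
       monoid.mult = (\<lambda>A B. {\<gamma>. \<exists>\<alpha>\<in>A. \<exists>\<beta>\<in>B. homotopic_paths X (\<alpha> +++ \<beta>) \<gamma>}),
       one = path_class X (\<lambda>_. x) \<rparr>"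

definition open_nbhd :: "'a::topological_space set \<Rightarrow> 'a \<Rightarrow> 'a set \<Rightarrow> bool" where
  "open_nbhd X x U \<longleftrightarrow> openin (top_of_set X) U \<and> x \<in> U"

definition small_loop :: "'a::topological_space set \<Rightarrow> 'a \<Rightarrow> (real \<Rightarrow> 'a) \<Rightarrow> bool" where
  "small_loop X x \<alpha> \<longleftrightarrow>
     \<alpha> \<in> loops_at X x \<and>
     (\<forall>U. open_nbhd X x U \<longrightarrow> (\<exists>\<gamma>\<in>path_class X \<alpha>. path_image \<gamma> \<subseteq> U))"

definition pi1_s :: "'a::topological_space set \<Rightarrow> 'a \<Rightarrow> (real \<Rightarrow> 'a) set set" where
  "pi1_s X x = {path_class X \<alpha> | \<alpha>. small_loop X x \<alpha>}"

definition pi1_sg :: "'a::topological_space set \<Rightarrow> 'a \<Rightarrow> (real \<Rightarrow> 'a) set set" where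
  "pi1_sg X x =
     generate (fundamental_group X x)
       {path_class X (\<alpha> +++ \<beta> +++ reversepath \<alpha>) | \<alpha> \<beta>.
          \<alpha> \<in> paths_from X x \<and> \<beta> \<in> loops_at X (pathfinish \<alpha>) \<and>
          path_class X \<beta> \<in> pi1_s X (pathfinish \<alpha>)}"

text \<open>
  In the next definition \<open>\<beta>\<close> runs in \<open>V\<close> but is small as a loop in \<open>X\<close>, and the homotopy
  may leave \<open>U\<close>.
\<close>

definition SSLT_at :: "'a::topological_space set \<Rightarrow> 'a \<Rightarrow> bool" where
  "SSLT_at X x \<longleftrightarrow>
     (\<forall>\<alpha>\<in>paths_from X x. \<forall>U. open_nbhd X x U \<longrightarrow>
        (\<exists>V. open_nbhd X (pathfinish \<alpha>) V \<and>
           (\<forall>\<beta>. small_loop X (pathfinish \<alpha>) \<beta> \<and> path_image \<beta> \<subseteq> V \<longrightarrow>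
              (\<exists>\<gamma>\<in>loops_at U x.
                 homotopic_paths X \<gamma> (\<alpha> +++ \<beta> +++ reversepath \<alpha>)))))"

end

theory Submission
  imports Defs
begin

text \<open>
  The small classes form a subgroup of the fundamental group, and conjugating by the constant path
  shows that \<open>pi1_s X x \<subseteq> pi1_sg X x\<close> always holds. So the equality says exactly that every
  conjugate of a small class by a path from \<open>x\<close> is again small at \<open>x\<close>. SSLT gives this because
  a small loop can first be moved into the neighbourhood \<open>V\<close>; conversely, \<open>V = X\<close> works for
  every path and every neighbourhood.
\<close>

text \<open>
  The library proves the unit and inverse laws only in normed spaces, where constant paths are
  degenerate segments. They transfer to arbitrary spaces as images, under the path \<open>p\<close>, of the laws
  for the identity path of \<open>{0..1}\<close>.
\<close>

lemma homotopic_paths_image_unit_interval: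
  assumes "path p" "path_image p \<subseteq> S" "homotopic_paths {0..1} f g"
  shows "homotopic_paths S (p \<circ> f) (p \<circ> g)"
  using assms by (intro homotopic_paths_continuous_image[OF assms(3)])
    (auto simp: path_def path_image_def)

lemma homotopic_paths_const_lid:
  assumes "path p" "path_image p \<subseteq> S" "pathstart p = x"
  shows "homotopic_paths S ((\<lambda>_. x) +++ p) p"
proof -
  have "homotopic_paths {0..1::real} (linepath 0 0 +++ id) id"
    by (rule homotopic_paths_lid') (auto simp: path_def path_image_def pathstart_def)
  then have "homotopic_paths S (p \<circ> (linepath 0 0 +++ id)) (p \<circ> id)"
    by (rule homotopic_paths_image_unit_interval[OF assms(1,2)])
  \<comment> \<open>Composition with \<open>p\<close> commutes with the case split in
    \<open>+++\<close>, so the equality holds on the whole real line; \<open>p 0 = x\<close> makes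
    the image of the degenerate segment the constant path at \<open>x\<close>.\<close>
  moreover have "p \<circ> (linepath 0 0 +++ id) = (\<lambda>_. x) +++ p"
    using assms(3) by (auto simp: joinpaths_def linepath_def pathstart_def fun_eq_iff)
  ultimately show ?thesis by simp
qed

lemma homotopic_paths_const_rid:
  assumes "path p" "path_image p \<subseteq> S" "pathfinish p = x"
  shows "homotopic_paths S (p +++ (\<lambda>_. x)) p"
proof -
  have "homotopic_paths {0..1::real} (id +++ linepath 1 1) id"
    by (rule homotopic_paths_rid') (auto simp: path_def path_image_def pathfinish_def)
  then have "homotopic_paths S (p \<circ> (id +++ linepath 1 1)) (p \<circ> id)"
    by (rule homotopic_paths_image_unit_interval[OF assms(1,2)])
  moreover have "p \<circ> (id +++ linepath 1 1) = p +++ (\<lambda>_. x)"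
    using assms(3) by (auto simp: joinpaths_def linepath_def pathfinish_def fun_eq_iff)
  ultimately show ?thesis by simp
qed

lemma homotopic_paths_const_linv:
  assumes "path p" "path_image p \<subseteq> S" "pathfinish p = x"
  shows "homotopic_paths S (reversepath p +++ p) (\<lambda>_. x)"
proof -
  have "homotopic_paths {0..1::real} (reversepath id +++ id) (linepath 1 1)"
    using homotopic_paths_linv[of "id::real \<Rightarrow> real" "{0..1}"]
    by (auto simp: path_def path_image_def pathfinish_def)
  then have "homotopic_paths S (p \<circ> (reversepath id +++ id)) (p \<circ> linepath 1 1)"
    by (rule homotopic_paths_image_unit_interval[OF assms(1,2)])
  moreover have "p \<circ> (reversepath id +++ id) = reversepath p +++ p"
    by (auto simp: joinpaths_def reversepath_def fun_eq_iff)
  moreover have "p \<circ> linepath 1 1 = (\<lambda>_. x)"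
    using assms(3) by (auto simp: linepath_def pathfinish_def fun_eq_iff)
  ultimately show ?thesis by simp
qed

section \<open>Loops, conjugates and homotopy classes\<close>

lemma loops_at_iff:
  "\<alpha> \<in> loops_at X x \<longleftrightarrow>
    path \<alpha> \<and> path_image \<alpha> \<subseteq> X \<and> pathstart \<alpha> = x \<and> pathfinish \<alpha> = x"
  by (auto simp: loops_at_def paths_from_def)

lemma const_in_loops_at: "x \<in> X \<Longrightarrow> (\<lambda>_. x) \<in> loops_at X x"
  by (auto simp: loops_at_iff path_def path_image_def pathstart_def pathfinish_def)

lemma join_in_loops_at:
  "\<alpha> \<in> loops_at X x \<Longrightarrow> \<beta> \<in> loops_at X x \<Longrightarrow> \<alpha> +++ \<beta> \<in> loops_at X x"
  by (auto simp: loops_at_iff path_image_join)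

lemma reversepath_in_loops_at: "\<alpha> \<in> loops_at X x \<Longrightarrow> reversepath \<alpha> \<in> loops_at X x"
  by (auto simp: loops_at_iff)

lemma conjugate_in_loops_at:
  "\<alpha> \<in> paths_from X x \<Longrightarrow> \<beta> \<in> loops_at X (pathfinish \<alpha>) \<Longrightarrow>
    \<alpha> +++ \<beta> +++ reversepath \<alpha> \<in> loops_at X x"
  by (auto simp: loops_at_iff paths_from_def path_image_join)

lemma homotopic_paths_loops_at:
  assumes "homotopic_paths X \<alpha> \<beta>" "\<alpha> \<in> loops_at X x"
  shows "\<beta> \<in> loops_at X x"
  using assms(2) homotopic_paths_imp_path[OF assms(1)] homotopic_paths_imp_subset[OF assms(1)]
    homotopic_paths_imp_pathstart[OF assms(1)] homotopic_paths_imp_pathfinish[OF assms(1)]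
  by (simp add: loops_at_iff)

lemma homotopic_paths_conjugate:
  assumes "\<alpha> \<in> paths_from X x" "\<beta> \<in> loops_at X (pathfinish \<alpha>)" "homotopic_paths X \<beta> \<beta>'"
  shows "homotopic_paths X (\<alpha> +++ \<beta> +++ reversepath \<alpha>) (\<alpha> +++ \<beta>' +++ reversepath \<alpha>)"
  using assms by (intro homotopic_paths_join) (auto simp: loops_at_iff paths_from_def)

lemma path_class_eqI: "homotopic_paths X \<alpha> \<beta> \<Longrightarrow> path_class X \<alpha> = path_class X \<beta>"
  unfolding path_class_def using homotopic_paths_sym homotopic_paths_trans by blast

text \<open>A function that is not a path in \<open>X\<close> has an empty class, so equal classes
  alone give no homotopy. The loop hypothesis makes \<open>homotopic_paths X\<close> reflexive at
  \<open>\<beta>\<close> and so puts \<open>\<beta>\<close> in its own class.\<close>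

lemma path_class_eqD:
  assumes "path_class X \<alpha> = path_class X \<beta>" "\<beta> \<in> loops_at X x"
  shows "homotopic_paths X \<alpha> \<beta>"
  using assms by (auto simp: path_class_def loops_at_iff set_eq_iff)

section \<open>The group structure on classes of loops\<close>

lemma carrier_fundamental_group [simp]:
  "carrier (fundamental_group X x) = path_class X ` loops_at X x"
  by (simp add: fundamental_group_def)

lemma one_fundamental_group [simp]:
  "\<one>\<^bsub>fundamental_group X x\<^esub> = path_class X (\<lambda>_. x)"
  by (simp add: fundamental_group_def)

text \<open>Concatenation respects homotopy, so the union over all representatives in
  \<open>monoid.mult\<close> collapses to one class. As a simp rule this reduces the group laws to
  homotopies between loops.\<close>

lemma mult_fundamental_group [simp]:
  assumes "\<alpha> \<in> loops_at X x" "\<beta> \<in> loops_at X x"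
  shows "path_class X \<alpha> \<otimes>\<^bsub>fundamental_group X x\<^esub> path_class X \<beta> = path_class X (\<alpha> +++ \<beta>)"
proof -
  have "(\<exists>\<alpha>'\<in>path_class X \<alpha>. \<exists>\<beta>'\<in>path_class X \<beta>. homotopic_paths X (\<alpha>' +++ \<beta>') \<gamma>)
    \<longleftrightarrow> homotopic_paths X (\<alpha> +++ \<beta>) \<gamma>" (is "?L \<longleftrightarrow> ?R") for \<gamma>
  proof
    assume ?L
    then obtain \<alpha>' \<beta>' where h: "homotopic_paths X \<alpha> \<alpha>'" "homotopic_paths X \<beta> \<beta>'"
      "homotopic_paths X (\<alpha>' +++ \<beta>') \<gamma>"
      by (auto simp: path_class_def)
    have "homotopic_paths X (\<alpha> +++ \<beta>) (\<alpha>' +++ \<beta>')"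
      using h assms by (intro homotopic_paths_join) (auto simp: loops_at_iff)
    with h(3) show ?R by (rule homotopic_paths_trans[rotated])
  next
    assume ?R
    with assms show ?L
      by (intro bexI[of _ \<alpha>] bexI[of _ \<beta>]) (auto simp: path_class_def loops_at_iff)
  qed
  then show ?thesis
    by (simp add: fundamental_group_def path_class_def)
qed

lemma fundamental_group_reversepath_mult:
  assumes "\<alpha> \<in> loops_at X x"
  shows "path_class X (reversepath \<alpha>) \<otimes>\<^bsub>fundamental_group X x\<^esub> path_class X \<alpha> =
    \<one>\<^bsub>fundamental_group X x\<^esub>"
proof -
  have "homotopic_paths X (reversepath \<alpha> +++ \<alpha>) (\<lambda>_. x)"
    using assms by (intro homotopic_paths_const_linv) (auto simp: loops_at_iff)
  with assms show ?thesis
    by (simp add: reversepath_in_loops_at path_class_eqI)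
qed

lemma group_fundamental_group:
  assumes "x \<in> X"
  shows "group (fundamental_group X x)"
\<comment> \<open>\<open>groupI\<close> asks for the unit and inverse laws on the left only.\<close>
proof (rule groupI)
  let ?G = "fundamental_group X x"
  show "\<one>\<^bsub>?G\<^esub> \<in> carrier ?G"
    using assms by (simp add: const_in_loops_at)
next
  let ?G = "fundamental_group X x"
  fix a assume "a \<in> carrier ?G"
  then obtain \<alpha> where \<alpha>: "\<alpha> \<in> loops_at X x" "a = path_class X \<alpha>" by auto
  then have "homotopic_paths X ((\<lambda>_. x) +++ \<alpha>) \<alpha>"
    by (intro homotopic_paths_const_lid) (auto simp: loops_at_iff)
  with assms \<alpha> show "\<one>\<^bsub>?G\<^esub> \<otimes>\<^bsub>?G\<^esub> a = a"
    by (simp add: const_in_loops_at path_class_eqI)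
  show "\<exists>b\<in>carrier ?G. b \<otimes>\<^bsub>?G\<^esub> a = \<one>\<^bsub>?G\<^esub>"
    using fundamental_group_reversepath_mult[OF \<alpha>(1)] reversepath_in_loops_at[OF \<alpha>(1)] \<alpha>(2)
    by (intro bexI[of _ "path_class X (reversepath \<alpha>)"]) auto
next
  let ?G = "fundamental_group X x"
  fix a b assume "a \<in> carrier ?G" "b \<in> carrier ?G"
  then show "a \<otimes>\<^bsub>?G\<^esub> b \<in> carrier ?G" by (auto simp: join_in_loops_at)
next
  let ?G = "fundamental_group X x"
  fix a b c assume "a \<in> carrier ?G" "b \<in> carrier ?G" "c \<in> carrier ?G"
  then obtain \<alpha> \<beta> \<gamma> where *: "\<alpha> \<in> loops_at X x" "\<beta> \<in> loops_at X x" "\<gamma> \<in> loops_at X x"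
    "a = path_class X \<alpha>" "b = path_class X \<beta>" "c = path_class X \<gamma>" by auto
  have "homotopic_paths X ((\<alpha> +++ \<beta>) +++ \<gamma>) (\<alpha> +++ \<beta> +++ \<gamma>)"
    using * by (intro homotopic_paths_sym[OF homotopic_paths_assoc]) (auto simp: loops_at_iff)
  with * show "a \<otimes>\<^bsub>?G\<^esub> b \<otimes>\<^bsub>?G\<^esub> c = a \<otimes>\<^bsub>?G\<^esub> (b \<otimes>\<^bsub>?G\<^esub> c)"
    by (simp add: join_in_loops_at path_class_eqI)
qed

lemma inv_fundamental_group:
  assumes "\<alpha> \<in> loops_at X x"
  shows "inv\<^bsub>fundamental_group X x\<^esub> path_class X \<alpha> = path_class X (reversepath \<alpha>)"
proof -
  have "x \<in> X"
    using assms pathstart_in_path_image[of \<alpha>] by (auto simp: loops_at_iff)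
  then interpret group "fundamental_group X x" by (rule group_fundamental_group)
  show ?thesis
    using assms reversepath_in_loops_at
    by (intro inv_equality fundamental_group_reversepath_mult) auto
qed

section \<open>Small loops and the subgroup of their classes\<close>

lemma small_loopD:
  assumes "small_loop X x \<alpha>" "open_nbhd X x U"
  obtains \<gamma> where "homotopic_paths X \<alpha> \<gamma>" "path_image \<gamma> \<subseteq> U" "\<gamma> \<in> loops_at U x"
proof -
  obtain \<gamma> where \<gamma>: "homotopic_paths X \<alpha> \<gamma>" "path_image \<gamma> \<subseteq> U"
    using assms by (auto simp: small_loop_def path_class_def)
  \<comment> \<open>The homotopy fixes end points, so the representative inside \<open>U\<close> is
    still based at \<open>x\<close> and is a loop of \<open>U\<close> there.\<close>
  then have "\<gamma> \<in> loops_at X x"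
    using assms(1) homotopic_paths_loops_at[OF \<gamma>(1)] by (simp add: small_loop_def)
  with \<gamma> show thesis by (intro that) (auto simp: loops_at_iff)
qed

text \<open>The neighbourhood condition speaks only of the class, which homotopic loops
  share.\<close>

lemma small_loop_homotopic:
  assumes "small_loop X x \<alpha>" "homotopic_paths X \<alpha> \<beta>"
  shows "small_loop X x \<beta>"
  using assms(1) homotopic_paths_loops_at[OF assms(2)]
  unfolding small_loop_def path_class_eqI[OF assms(2)] by blast

text \<open>\<open>pi1_s\<close> only provides some small representative of the class; homotopy
  invariance passes smallness on to the given one. This is the bridge between statements on classes
  and statements on loops.\<close>

lemma path_class_in_pi1_s_iff:
  assumes "\<beta> \<in> loops_at X x"
  shows "path_class X \<beta> \<in> pi1_s X x \<longleftrightarrow> small_loop X x \<beta>"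
proof
  assume "path_class X \<beta> \<in> pi1_s X x"
  then obtain \<alpha> where \<alpha>: "small_loop X x \<alpha>" "path_class X \<alpha> = path_class X \<beta>"
    by (auto simp: pi1_s_def)
  then show "small_loop X x \<beta>"
    using assms small_loop_homotopic[OF \<alpha>(1) path_class_eqD] by blast
qed (auto simp: pi1_s_def)

lemma small_loop_const:
  assumes "x \<in> X"
  shows "small_loop X x (\<lambda>_. x)"
  unfolding small_loop_def
proof (intro conjI allI impI)
  show const: "(\<lambda>_. x) \<in> loops_at X x"
    using assms by (rule const_in_loops_at)
  fix U assume "open_nbhd X x U"
  with const show "\<exists>\<gamma>\<in>path_class X (\<lambda>_. x). path_image \<gamma> \<subseteq> U"
    by (intro bexI[of _ "\<lambda>_. x"])
      (auto simp: path_class_def loops_at_iff open_nbhd_def path_image_def)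
qed

text \<open>Both factors deform into the same \<open>U\<close>, and concatenating the deformed loops
  does not leave it.\<close>

lemma small_loop_join:
  assumes "small_loop X x \<alpha>" "small_loop X x \<beta>"
  shows "small_loop X x (\<alpha> +++ \<beta>)"
  unfolding small_loop_def
proof (intro conjI allI impI)
  show "\<alpha> +++ \<beta> \<in> loops_at X x"
    using assms by (auto simp: small_loop_def join_in_loops_at)
  fix U assume U: "open_nbhd X x U"
  obtain \<alpha>' where \<alpha>': "homotopic_paths X \<alpha> \<alpha>'" "path_image \<alpha>' \<subseteq> U"
    using small_loopD[OF assms(1) U] by blast
  obtain \<beta>' where \<beta>': "homotopic_paths X \<beta> \<beta>'" "path_image \<beta>' \<subseteq> U"
    using small_loopD[OF assms(2) U] by blast
  have "homotopic_paths X (\<alpha> +++ \<beta>) (\<alpha>' +++ \<beta>')"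
    using \<alpha>' \<beta>' assms by (intro homotopic_paths_join) (auto simp: small_loop_def loops_at_iff)
  moreover have "path_image (\<alpha>' +++ \<beta>') \<subseteq> U"
    using \<alpha>' \<beta>' path_image_join_subset by blast
  ultimately show "\<exists>\<gamma>\<in>path_class X (\<alpha> +++ \<beta>). path_image \<gamma> \<subseteq> U"
    by (auto simp: path_class_def)
qed

lemma small_loop_reversepath:
  assumes "small_loop X x \<alpha>"
  shows "small_loop X x (reversepath \<alpha>)"
  unfolding small_loop_def
proof (intro conjI allI impI)
  show "reversepath \<alpha> \<in> loops_at X x"
    using assms by (auto simp: small_loop_def reversepath_in_loops_at)
  fix U assume U: "open_nbhd X x U"
  obtain \<alpha>' where "homotopic_paths X \<alpha> \<alpha>'" "path_image \<alpha>' \<subseteq> U"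
    using small_loopD[OF assms U] by blast
  then show "\<exists>\<gamma>\<in>path_class X (reversepath \<alpha>). path_image \<gamma> \<subseteq> U"
    by (intro bexI[of _ "reversepath \<alpha>'"]) (auto simp: path_class_def homotopic_paths_reversepath)
qed

lemma subgroup_pi1_s:
  assumes "x \<in> X"
  shows "subgroup (pi1_s X x) (fundamental_group X x)"
proof (rule group.subgroupI[OF group_fundamental_group[OF assms]])
  have loops: "small_loop X x \<alpha> \<Longrightarrow> \<alpha> \<in> loops_at X x" for \<alpha>
    by (simp add: small_loop_def)
  show "pi1_s X x \<subseteq> carrier (fundamental_group X x)"
    using loops by (auto simp: pi1_s_def)
  show "pi1_s X x \<noteq> {}"
    using small_loop_const[OF assms] by (auto simp: pi1_s_def)
  show "inv\<^bsub>fundamental_group X x\<^esub> a \<in> pi1_s X x" if "a \<in> pi1_s X x" for a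
    using that loops small_loop_reversepath by (fastforce simp: pi1_s_def inv_fundamental_group)
  show "a \<otimes>\<^bsub>fundamental_group X x\<^esub> b \<in> pi1_s X x" if "a \<in> pi1_s X x" "b \<in> pi1_s X x" for a b
  proof -
    obtain \<alpha> \<beta> where "small_loop X x \<alpha>" "small_loop X x \<beta>"
      "a = path_class X \<alpha>" "b = path_class X \<beta>"
      using \<open>a \<in> pi1_s X x\<close> \<open>b \<in> pi1_s X x\<close> by (auto simp: pi1_s_def)
    then show ?thesis
      by (simp add: loops small_loop_join path_class_in_pi1_s_iff join_in_loops_at)
  qed
qed

section \<open>Conjugates of small loops along paths\<close>

lemma conjugate_small_loop_in_pi1_sg:
  assumes "\<alpha> \<in> paths_from X x" "small_loop X (pathfinish \<alpha>) \<beta>"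
  shows "path_class X (\<alpha> +++ \<beta> +++ reversepath \<alpha>) \<in> pi1_sg X x"
proof -
  have "\<beta> \<in> loops_at X (pathfinish \<alpha>)"
    using assms(2) by (simp add: small_loop_def)
  with assms show ?thesis
    unfolding pi1_sg_def using path_class_in_pi1_s_iff by (intro generate.incl) blast
qed

lemma pi1_s_subset_pi1_sg: "pi1_s X x \<subseteq> pi1_sg X x"
proof
  fix a assume "a \<in> pi1_s X x"
  then obtain \<beta> where \<beta>: "small_loop X x \<beta>" "a = path_class X \<beta>"
    by (auto simp: pi1_s_def)
  then have loop: "path \<beta>" "path_image \<beta> \<subseteq> X" "pathstart \<beta> = x" "pathfinish \<beta> = x"
    by (auto simp: small_loop_def loops_at_iff)
  then have "x \<in> X" using pathstart_in_path_image[of \<beta>] by auto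
  then have const: "(\<lambda>_. x) \<in> paths_from X x"
    using const_in_loops_at by (auto simp: loops_at_def)
  let ?c = "\<lambda>_::real. x"
  have rev: "reversepath ?c = ?c" by (simp add: reversepath_def)
  have r: "homotopic_paths X (\<beta> +++ ?c) \<beta>"
    using loop by (intro homotopic_paths_const_rid)
  \<comment> \<open>The constant factors are cancelled one at a time. The left unit law is applied
    to \<open>\<beta> +++ ?c\<close>, which is a path in \<open>X\<close> because it is an end of
    the homotopy \<open>r\<close>.\<close>
  have "homotopic_paths X (?c +++ \<beta> +++ ?c) (\<beta> +++ ?c)"
    using homotopic_paths_imp_path[OF r] homotopic_paths_imp_subset[OF r] loop
    by (intro homotopic_paths_const_lid) auto
  then have "homotopic_paths X (?c +++ \<beta> +++ reversepath ?c) \<beta>"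
    using r rev homotopic_paths_trans by metis
  then have "a = path_class X (?c +++ \<beta> +++ reversepath ?c)"
    using \<beta> path_class_eqI by metis
  then show "a \<in> pi1_sg X x"
    using conjugate_small_loop_in_pi1_sg[OF const] \<beta> by (simp add: pathfinish_def)
qed

lemma SSLT_at_conjugate_small_loop:
  assumes "SSLT_at X x" "\<alpha> \<in> paths_from X x" "small_loop X (pathfinish \<alpha>) \<beta>"
  shows "small_loop X x (\<alpha> +++ \<beta> +++ reversepath \<alpha>)"
  unfolding small_loop_def
proof (intro conjI allI impI)
  have \<beta>: "\<beta> \<in> loops_at X (pathfinish \<alpha>)"
    using assms(3) by (simp add: small_loop_def)
  then show "\<alpha> +++ \<beta> +++ reversepath \<alpha> \<in> loops_at X x"
    using assms(2) by (rule conjugate_in_loops_at[rotated])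
  fix U assume "open_nbhd X x U"
  then obtain V where V: "open_nbhd X (pathfinish \<alpha>) V"
    and transfer: "\<And>\<beta>. small_loop X (pathfinish \<alpha>) \<beta> \<Longrightarrow> path_image \<beta> \<subseteq> V \<Longrightarrow>
      \<exists>\<gamma>\<in>loops_at U x. homotopic_paths X \<gamma> (\<alpha> +++ \<beta> +++ reversepath \<alpha>)"
    using assms(1,2) unfolding SSLT_at_def by metis
  \<comment> \<open>\<open>\<beta>\<close> itself may leave \<open>V\<close>. Its smallness, tested
    on \<open>V\<close>, supplies a homotopic loop inside \<open>V\<close>, which is again small and
    so can be transferred.\<close>
  obtain \<beta>' where \<beta>': "homotopic_paths X \<beta> \<beta>'" "path_image \<beta>' \<subseteq> V"
    using small_loopD[OF assms(3) V] by blast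
  obtain \<gamma> where \<gamma>: "\<gamma> \<in> loops_at U x" "homotopic_paths X \<gamma> (\<alpha> +++ \<beta>' +++ reversepath \<alpha>)"
    using transfer[OF small_loop_homotopic[OF assms(3) \<beta>'(1)] \<beta>'(2)] by blast
  \<comment> \<open>Conjugation by \<open>\<alpha>\<close> preserves the homotopy from
    \<open>\<beta>\<close> to \<open>\<beta>'\<close>, so the loop found for \<open>\<beta>'\<close>
    also represents the conjugate of \<open>\<beta>\<close>.\<close>
  have "homotopic_paths X (\<alpha> +++ \<beta> +++ reversepath \<alpha>) \<gamma>"
    using homotopic_paths_conjugate[OF assms(2) \<beta> \<beta>'(1)] homotopic_paths_sym[OF \<gamma>(2)]
    by (rule homotopic_paths_trans)
  with \<gamma>(1) show "\<exists>\<gamma>\<in>path_class X (\<alpha> +++ \<beta> +++ reversepath \<alpha>). path_image \<gamma> \<subseteq> U"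
    by (auto simp: path_class_def loops_at_iff)
qed

theorem theorem3p6:
  fixes X :: "'a::topological_space set" and x0 :: 'a
  assumes "x0 \<in> X"
  shows "SSLT_at X x0 \<longleftrightarrow> pi1_s X x0 = pi1_sg X x0"
proof
  assume SSLT: "SSLT_at X x0"
  have "pi1_sg X x0 \<subseteq> pi1_s X x0"
    unfolding pi1_sg_def
  \<comment> \<open>The generated subgroup is the least one containing the generators, and
    \<open>pi1_s X x0\<close> is a subgroup, so only the generators need checking.\<close>
  proof (rule group.generate_subgroup_incl[OF group_fundamental_group _ subgroup_pi1_s])
    show "{path_class X (\<alpha> +++ \<beta> +++ reversepath \<alpha>) | \<alpha> \<beta>.
        \<alpha> \<in> paths_from X x0 \<and> \<beta> \<in> loops_at X (pathfinish \<alpha>) \<and>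
        path_class X \<beta> \<in> pi1_s X (pathfinish \<alpha>)} \<subseteq> pi1_s X x0"
      using SSLT_at_conjugate_small_loop[OF SSLT]
      by (auto simp: path_class_in_pi1_s_iff conjugate_in_loops_at)
  qed (fact assms)+
  with pi1_s_subset_pi1_sg show "pi1_s X x0 = pi1_sg X x0" by (rule subset_antisym)
next
  assume eq: "pi1_s X x0 = pi1_sg X x0"
  show "SSLT_at X x0"
    unfolding SSLT_at_def
  proof (intro ballI allI impI exI[of _ X] conjI)
    fix \<alpha> U
    assume \<alpha>: "\<alpha> \<in> paths_from X x0" and U: "open_nbhd X x0 U"
    show "open_nbhd X (pathfinish \<alpha>) X"
      using \<alpha> pathfinish_in_path_image[of \<alpha>] by (auto simp: open_nbhd_def paths_from_def)
    fix \<beta>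
    assume "small_loop X (pathfinish \<alpha>) \<beta> \<and> path_image \<beta> \<subseteq> X"
    then have \<beta>: "small_loop X (pathfinish \<alpha>) \<beta>" by simp
    then have "\<alpha> +++ \<beta> +++ reversepath \<alpha> \<in> loops_at X x0"
      using \<alpha> by (intro conjugate_in_loops_at) (auto simp: small_loop_def)
    \<comment> \<open>The assumed equality enters here: the class of the conjugate is a generator of
      \<open>pi1_sg X x0\<close>, hence a small class at \<open>x0\<close>.\<close>
    moreover have "path_class X (\<alpha> +++ \<beta> +++ reversepath \<alpha>) \<in> pi1_s X x0"
      unfolding eq using \<alpha> \<beta> by (rule conjugate_small_loop_in_pi1_sg)
    ultimately have "small_loop X x0 (\<alpha> +++ \<beta> +++ reversepath \<alpha>)"
      by (simp add: path_class_in_pi1_s_iff)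
    \<comment> \<open>Smallness of the conjugate, tested on the given \<open>U\<close>, produces the
      required loop.\<close>
    then obtain \<gamma> where "homotopic_paths X (\<alpha> +++ \<beta> +++ reversepath \<alpha>) \<gamma>" "\<gamma> \<in> loops_at U x0"
      using small_loopD[OF _ U] by blast
    then show "\<exists>\<gamma>\<in>loops_at U x0. homotopic_paths X \<gamma> (\<alpha> +++ \<beta> +++ reversepath \<alpha>)"
      using homotopic_paths_sym by blast
  qed
qed

end
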